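(* Let $W$ and $\tilde W$ be weight matrices of size $N$ on $(x_0,x_1)$, and let $\{P_n\}_{n\in\mathbb{N}_0}$ and $\{\tilde P_n\}_{n\in\mathbb{N}_0}$ be sequences of matrix-valued orthogonal polynomials with respect to $W$ and $\tilde W$, respectively. If there exists a differential operator $\mathcal{V}\in\operatorname{Mat}_N(\Omega[x])$ such that $$P_n(x)\cdot\mathcal{V}=A_n\tilde P_n(x)\quad\text{for all } n\in\mathbb{N}_0,$$ with $A_n\in\operatorname{Mat}_N(\mathbb{C})$ and $A_n$ invertible for some $n$, then $\{\tilde P_n\}$ is a Darboux transformation of $\{P_n\}$. The converse is also true: if $\{\tilde P_n\}$ is a Darboux transformation of $\{P_n\}$, then such a $\mathcal{V}$ exists.
   Context: Fix a possibly infinite interval $(x_0,x_1)$ of the real line. A weight matrix of size $N$ is a complex $N\times N$ matrix-valued smooth function $W$ on $(x_0,x_1)$ that is positive definite almost everywhere and has finite moments of all orders. For $P,Q\in\operatorname{Mat}_N(\mathbb{C}[x])$ put $\langle P,Q\rangle_W=\int_{x_0}^{x_1}P(x)W(x)Q(x)^*\,dx$, where $*$ is the Hermitian conjugate. A sequence of matrix-valued orthogonal polynomials with respect to $W$ is a sequence $\{P_n\}_{n\in\mathbb{N}_0}$ in $\operatorname{Mat}_N(\mathbb{C}[x])$, $\mathbb{N}_0=\{0,1,\dots\}$, with $P_n$ of degree $n$ with nonsingular leading coefficient and $\langle P_n,P_m\rangle_W=0$ for $n\ne m$. Differential operators $D=\sum_{i=0}^s\partial^iF_i(x)$, $\partial=\frac{d}{dx}$,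 act on the right: $(P\cdot D)(x)=\sum_{i=0}^s\frac{d^iP}{dx^i}(x)F_i(x)$, and $P\cdot(DE)=(P\cdot D)\cdot E$. $\operatorname{Mat}_N(\Omega[x])$ is the algebra of such operators with $F_i\in\operatorname{Mat}_N(\mathbb{C}[x])$. $\mathcal{D}(W)$ is the set of $D\in\operatorname{Mat}_N(\Omega[x])$ such that, for every $n\in\mathbb{N}_0$, $P_n\cdot D=\Lambda_n(D)P_n$ for some $\Lambda_n(D)\in\operatorname{Mat}_N(\mathbb{C})$ (this does not depend on the chosen orthogonal sequence $\{P_n\}$ for $W$). An operator $E\in\operatorname{Mat}_N(\Omega[x])$ is degree-preserving if, for all but finitely many $n\in\mathbb{N}_0$, for any (matrix) polynomial $f$ of degree $n$ the function $f\cdot E$ is again a polynomial of degree $n$. The sequence $\{\tilde P_n\}$ is a Darboux transformation of $\{P_n\}$ if there is $D\in\mathcal{D}(W)$ that can be factorized as $D=\mathcal{V}\mathcal{N}$ with degree-preserving $\mathcal{V},\mathcal{N}\in\operatorname{Mat}_N(\Omega[x])$ such that $P_n\cdot\mathcal{V}=A_n\tilde P_n$ for all $n\in\mathbb{N}_0$, for some matrices $A_n\in\operatorname{Mat}_N(\mathbb{C})$. For $D=\sum_j\partial^jF_j$ let $D^*=\sum_jF_j(x)^*(-1)^j\partial^j$ be the formal adjoint; thus $Q\cdot(WD^*W^{-1})=\sum_j(-1)^j\frac{d^j}{dx^j}(QWF_j^* )W^{-1}$. Standing assumption on weights: all weight matrices considered (including direct sums $W\oplus\tilde W$ of the weights considered,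 i.e. block diagonal matrices) are "good enough" in the following sense, written for a weight $W$ of size $N$: if $D\in\operatorname{Mat}_N(\Omega[x])$ and $A\in\operatorname{Mat}_N(\mathbb{C}[x])$ satisfy $\int_{x_0}^{x_1}PAW\,dx=\int_{x_0}^{x_1}P\,(W\cdot D)\,dx$ for all $P\in\operatorname{Mat}_N(\mathbb{C}[x])$, then $AW=W\cdot D$. In particular, whenever $D,\tilde D\in\operatorname{Mat}_N(\Omega[x])$ satisfy $\langle P\cdot D,Q\rangle_W=\langle P,Q\cdot\tilde D\rangle_W$ for all $P,Q\in\operatorname{Mat}_N(\mathbb{C}[x])$, one has $\tilde D=WD^*W^{-1}$. *)

theory Defs
  imports "HOL-Analysis.Analysis" "HOL-Computational_Algebra.Polynomial"
begin

section \<open>Matrix polynomials\<close>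

text \<open>
  An element of \<open>Mat\<^sub>N(\<complex>[x])\<close> is an \<open>N \<times> N\<close> matrix with entries in \<^typ>\<open>complex poly\<close>, where \<open>N\<close> is the
  cardinality of the finite index type.  The matrix product is \<open>**\<close>; the
  type-class product \<open>*\<close> on vectors is entrywise and is never used here.
\<close>

type_synonym 'n matpoly = "complex poly ^ 'n ^ 'n"

definition const_mat :: "complex ^ 'n ^ 'n::finite \<Rightarrow> 'n matpoly" where
  "const_mat A = map_matrix (\<lambda>c. [:c:]) A"

definition mat_eval :: "'n::finite matpoly \<Rightarrow> real \<Rightarrow> complex ^ 'n ^ 'n" where
  "mat_eval P x = map_matrix (\<lambda>p. poly p (complex_of_real x)) P"

definition mat_coeff :: "'n::finite matpoly \<Rightarrow> nat \<Rightarrow> complex ^ 'n ^ 'n" where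
  "mat_coeff P n = map_matrix (\<lambda>p. coeff p n) P"

definition mat_degree :: "'n::finite matpoly \<Rightarrow> nat" where
  "mat_degree P = Max {degree (P $ i $ j) |i j. True}"

definition mat_pderiv :: "'n::finite matpoly \<Rightarrow> 'n matpoly" where
  "mat_pderiv P = map_matrix pderiv P"

section \<open>Right-acting differential operators\<close>

text \<open>
  The operator \<open>D = \<Sum>\<^sub>i \<partial>\<^sup>i F\<^sub>i(x)\<close> is encoded by the finitely supported family of its coefficients
  \<open>F\<^sub>i = coeff D i\<close>.  Only the additive structure of the outer polynomial type is
  used; composition of operators is \<open>diffop_mult\<close> below.
\<close>

type_synonym 'n diffop = "'n matpoly poly"

definition diffop_act :: "'n::finite matpoly \<Rightarrow> 'n diffop \<Rightarrow> 'n matpoly" where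
  "diffop_act P D = (\<Sum>i\<le>degree D. (mat_pderiv ^^ i) P ** coeff D i)"

text \<open>
  By the Leibniz rule, \<open>(\<partial>\<^sup>i F)(\<partial>\<^sup>j G) = \<Sum>\<^sub>k (j choose k) \<partial>\<^sup>i\<^sup>+\<^sup>k F\<^sup>(\<^sup>j\<^sup>-\<^sup>k\<^sup>) G\<close> for the right action;
  see \<open>diffop_act_mult\<close>.
\<close>

definition diffop_mult :: "'n::finite diffop \<Rightarrow> 'n diffop \<Rightarrow> 'n diffop" where
  "diffop_mult D E =
    (\<Sum>i\<le>degree D. \<Sum>j\<le>degree E. \<Sum>k\<le>j.
      monom (map_matrix (\<lambda>p. of_nat (j choose k) * p)
              ((mat_pderiv ^^ (j - k)) (coeff D i) ** coeff E j)) (i + k))"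

lemma diffop_act_eq_sum:
  assumes "degree D \<le> m"
  shows "diffop_act P D = (\<Sum>i\<le>m. (mat_pderiv ^^ i) P ** coeff D i)"
  unfolding diffop_act_def
  by (rule sum.mono_neutral_left)
     (use assms in \<open>auto simp: coeff_eq_0 matrix_matrix_mult_def vec_eq_iff not_le\<close>)

lemma diffop_act_0 [simp]: "diffop_act P 0 = 0"
  by (simp add: diffop_act_def matrix_matrix_mult_def vec_eq_iff)

lemma diffop_act_add: "diffop_act P (D + E) = diffop_act P D + diffop_act P E"
proof -
  define m where "m = max (degree D) (degree E)"
  have "degree (D + E) \<le> m" "degree D \<le> m" "degree E \<le> m"
    by (auto simp: m_def degree_add_le_max)
  then show ?thesis
    by (simp add: diffop_act_eq_sum matrix_add_ldistrib sum.distrib)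
qed

lemma diffop_act_sum: "diffop_act P (\<Sum>i\<in>I. f i) = (\<Sum>i\<in>I. diffop_act P (f i))"
  by (induction I rule: infinite_finite_induct) (simp_all add: diffop_act_add)

lemma diffop_act_monom: "diffop_act P (monom F n) = (mat_pderiv ^^ n) P ** F"
proof -
  have "diffop_act P (monom F n) = (\<Sum>i\<le>n. (mat_pderiv ^^ i) P ** coeff (monom F n) i)"
    by (rule diffop_act_eq_sum) (simp add: degree_monom_le)
  also have "\<dots> = (\<Sum>i\<in>{n}. (mat_pderiv ^^ i) P ** coeff (monom F n) i)"
    by (rule sum.mono_neutral_right) (auto simp: matrix_matrix_mult_def vec_eq_iff)
  finally show ?thesis by simp
qed

lemma nth_mat_pderiv_pow: "(mat_pderiv ^^ n) P $ i $ j = (pderiv ^^ n) (P $ i $ j)"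
  by (induction n) (simp_all add: mat_pderiv_def)

lemma higher_pderiv_mult:
  fixes p q :: "complex poly"
  shows "(pderiv ^^ n) (p * q) =
    (\<Sum>k\<le>n. of_nat (n choose k) * ((pderiv ^^ k) p * (pderiv ^^ (n - k)) q))"
proof (induction n)
  case (Suc n)
  have pderiv_sum: "pderiv (sum f A) = (\<Sum>x\<in>A. pderiv (f x))"
    for f :: "nat \<Rightarrow> complex poly" and A
    using higher_pderiv_sum[of 1 f A] by simp
  have pderiv_of_nat: "pderiv (of_nat c * r) = of_nat c * pderiv r" for c and r :: "complex poly"
    by (simp add: of_nat_poly pderiv_smult)
  let ?t = "\<lambda>k l. (pderiv ^^ k) p * (pderiv ^^ l) q"
  have "(pderiv ^^ Suc n) (p * q) =
      (\<Sum>k\<le>n. of_nat (n choose k) * (?t (Suc k) (n - k) + ?t k (Suc (n - k))))"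
    by (simp add: Suc.IH pderiv_sum pderiv_of_nat pderiv_mult distrib_left ac_simps)
  also have "\<dots> = (\<Sum>k\<le>n. of_nat (n choose k) * ?t (Suc k) (n - k))
      + (\<Sum>k\<le>n. of_nat (n choose k) * ?t k (Suc n - k))"
    by (simp add: distrib_left sum.distrib Suc_diff_le del: funpow.simps)
  also have "(\<Sum>k\<le>n. of_nat (n choose k) * ?t k (Suc n - k)) =
      (\<Sum>k\<le>Suc n. of_nat (n choose k) * ?t k (Suc n - k))"
    by simp
  also have "\<dots> = ?t 0 (Suc n) + (\<Sum>k\<le>n. of_nat (n choose Suc k) * ?t (Suc k) (n - k))"
    by (subst sum.atMost_Suc_shift) (simp del: funpow.simps add: funpow_0)
  also have "(\<Sum>k\<le>n. of_nat (n choose k) * ?t (Suc k) (n - k)) +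
      (?t 0 (Suc n) + (\<Sum>k\<le>n. of_nat (n choose Suc k) * ?t (Suc k) (n - k))) =
      ?t 0 (Suc n) + (\<Sum>k\<le>n. of_nat (Suc n choose Suc k) * ?t (Suc k) (n - k))"
    by (simp add: sum.distrib distrib_right del: funpow.simps)
  also have "\<dots> = (\<Sum>k\<le>Suc n. of_nat (Suc n choose k) * ?t k (Suc n - k))"
    by (subst sum.atMost_Suc_shift) (simp del: funpow.simps add: funpow_0)
  finally show ?case .
qed simp

lemma mat_pderiv_pow_mult:
  "(mat_pderiv ^^ n) (P ** Q) =
    (\<Sum>k\<le>n. map_matrix (\<lambda>p. of_nat (n choose k) * p)
      ((mat_pderiv ^^ k) P ** (mat_pderiv ^^ (n - k)) Q))"
  by (simp add: vec_eq_iff nth_mat_pderiv_pow matrix_matrix_mult_def higher_pderiv_sum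
      higher_pderiv_mult sum_distrib_left sum.swap[of _ "{..n}"])

lemma mat_pderiv_pow_sum:
  "(mat_pderiv ^^ n) (\<Sum>i\<in>I. f i) = (\<Sum>i\<in>I. (mat_pderiv ^^ n) (f i))"
  by (simp add: vec_eq_iff nth_mat_pderiv_pow higher_pderiv_sum)

lemma mat_mult_sum_left: "(\<Sum>i\<in>I. f i) ** B = (\<Sum>i\<in>I. f i ** (B :: 'n::finite matpoly))"
  by (induction I rule: infinite_finite_induct)
     (simp_all add: matrix_matrix_mult_def vec_eq_iff distrib_right sum.distrib)

lemma map_matrix_mult_left:
  "map_matrix (\<lambda>p. c * p) A ** B = map_matrix (\<lambda>p. c * p) (A ** (B :: 'n::finite matpoly))"
  by (simp add: vec_eq_iff matrix_matrix_mult_def sum_distrib_left mult.assoc)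

lemma map_matrix_mult_right:
  "A ** map_matrix (\<lambda>p. c * p) B = map_matrix (\<lambda>p. c * p) (A ** (B :: 'n::finite matpoly))"
  by (simp add: vec_eq_iff matrix_matrix_mult_def sum_distrib_left mult.left_commute)

lemma mat_pderiv_pow_add:
  "(mat_pderiv ^^ k) ((mat_pderiv ^^ i) P) = (mat_pderiv ^^ (i + k)) P"
  by (metis add.commute comp_apply funpow_add)

lemma diffop_act_mult: "diffop_act P (diffop_mult D E) = diffop_act (diffop_act P D) E"
proof -
  have "diffop_act (diffop_act P D) E =
      (\<Sum>j\<le>degree E. \<Sum>i\<le>degree D. \<Sum>k\<le>j. map_matrix (\<lambda>p. of_nat (j choose k) * p)
        ((mat_pderiv ^^ (i + k)) P ** ((mat_pderiv ^^ (j - k)) (coeff D i) ** coeff E j)))"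
    unfolding diffop_act_def
    by (simp add: mat_pderiv_pow_sum mat_mult_sum_left mat_pderiv_pow_mult map_matrix_mult_left
        mat_pderiv_pow_add matrix_mul_assoc)
  also have "\<dots> = diffop_act P (diffop_mult D E)"
    by (simp add: diffop_mult_def diffop_act_sum diffop_act_monom map_matrix_mult_right
        sum.swap[of _ "{..degree E}"])
  finally show ?thesis ..
qed

definition degree_preserving :: "'n::finite diffop \<Rightarrow> bool" where
  "degree_preserving E \<longleftrightarrow>
    finite {n. \<not> (\<forall>f. mat_degree f = n \<longrightarrow> mat_degree (diffop_act f E) = n)}"

section \<open>Weight matrices\<close>

text \<open>
  The interval \<open>(x\<^sub>0,x\<^sub>1)\<close> is \<open>einterval x0 x1\<close> with endpoints of type \<^typ>\<open>ereal\<close>; values of a weight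
  outside of it are irrelevant.
\<close>

definition hermitian_conj :: "complex ^ 'n ^ 'n::finite \<Rightarrow> complex ^ 'n ^ 'n" where
  "hermitian_conj A = transpose (map_matrix cnj A)"

definition positive_definite :: "complex ^ 'n ^ 'n::finite \<Rightarrow> bool" where
  "positive_definite A \<longleftrightarrow> hermitian_conj A = A \<and>
    (\<forall>v. v \<noteq> 0 \<longrightarrow> 0 < Re (\<Sum>i\<in>UNIV. \<Sum>j\<in>UNIV. cnj (v $ i) * A $ i $ j * v $ j))"

definition higher_vderiv :: "nat \<Rightarrow> (real \<Rightarrow> 'a::real_normed_vector) \<Rightarrow> real \<Rightarrow> 'a" where
  "higher_vderiv k f = ((\<lambda>g x. vector_derivative g (at x)) ^^ k) f"

definition weight_matrix :: "ereal \<Rightarrow> ereal \<Rightarrow> (real \<Rightarrow> complex ^ 'n ^ 'n::finite) \<Rightarrow> bool" where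
  "weight_matrix x0 x1 W \<longleftrightarrow>
    (\<forall>k. \<forall>x\<in>einterval x0 x1. higher_vderiv k W differentiable (at x)) \<and>
    (AE x\<in>einterval x0 x1 in lborel. positive_definite (W x)) \<and>
    (\<forall>n. set_integrable lborel (einterval x0 x1) (\<lambda>x. x ^ n *\<^sub>R W x))"

definition weight_inner ::
  "ereal \<Rightarrow> ereal \<Rightarrow> (real \<Rightarrow> complex ^ 'n ^ 'n::finite) \<Rightarrow> 'n matpoly \<Rightarrow> 'n matpoly
    \<Rightarrow> complex ^ 'n ^ 'n" where
  "weight_inner x0 x1 W P Q =
    (LBINT x:einterval x0 x1. mat_eval P x ** W x ** hermitian_conj (mat_eval Q x))"

definition orthogonal_polys ::
  "ereal \<Rightarrow> ereal \<Rightarrow> (real \<Rightarrow> complex ^ 'n ^ 'n::finite) \<Rightarrow> (nat \<Rightarrow> 'n matpoly) \<Rightarrow> bool" where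
  "orthogonal_polys x0 x1 W P \<longleftrightarrow>
    (\<forall>n. mat_degree (P n) = n \<and> invertible (mat_coeff (P n) n)) \<and>
    (\<forall>n m. n \<noteq> m \<longrightarrow> weight_inner x0 x1 W (P n) (P m) = 0)"

definition direct_sum ::
  "(real \<Rightarrow> complex ^ 'n ^ 'n::finite) \<Rightarrow> (real \<Rightarrow> complex ^ 'm ^ 'm::finite)
    \<Rightarrow> real \<Rightarrow> complex ^ ('n + 'm) ^ ('n + 'm)" where
  "direct_sum W V x = (\<chi> i j. case (i, j) of
      (Inl a, Inl b) \<Rightarrow> W x $ a $ b
    | (Inr a, Inr b) \<Rightarrow> V x $ a $ b
    | _ \<Rightarrow> 0)"

definition weight_act ::
  "(real \<Rightarrow> complex ^ 'n ^ 'n::finite) \<Rightarrow> 'n diffop \<Rightarrow> real \<Rightarrow> complex ^ 'n ^ 'n" where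
  "weight_act W D x = (\<Sum>i\<le>degree D. higher_vderiv i W x ** mat_eval (coeff D i) x)"

text \<open>
  The existence of the integrals of \<open>P (W \<sqdot> D)\<close> is an explicit premise, because a Bochner integral of a
  non-integrable function is \<open>0\<close> by convention.  The integrals of \<open>P A W\<close> exist by finiteness of
  the moments of \<open>W\<close>.
\<close>

definition good_weight :: "ereal \<Rightarrow> ereal \<Rightarrow> (real \<Rightarrow> complex ^ 'n ^ 'n::finite) \<Rightarrow> bool" where
  "good_weight x0 x1 W \<longleftrightarrow>
    (\<forall>(D :: 'n diffop) (A :: 'n matpoly).
      (\<forall>P :: 'n matpoly.
        set_integrable lborel (einterval x0 x1) (\<lambda>x. mat_eval P x ** weight_act W D x) \<and>
        (LBINT x:einterval x0 x1. mat_eval P x ** mat_eval A x ** W x) =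
        (LBINT x:einterval x0 x1. mat_eval P x ** weight_act W D x))
      \<longrightarrow> (\<forall>x\<in>einterval x0 x1. mat_eval A x ** W x = weight_act W D x))"

section \<open>The algebra of a weight and Darboux transformations\<close>

text \<open>
  Membership in \<open>\<D>(W)\<close> does not depend on the chosen orthogonal sequence: two such sequences differ by
  left multiplication of each term by a nonsingular constant matrix.
\<close>

definition weight_algebra ::
  "ereal \<Rightarrow> ereal \<Rightarrow> (real \<Rightarrow> complex ^ 'n ^ 'n::finite) \<Rightarrow> 'n diffop set" where
  "weight_algebra x0 x1 W =
    {D. \<exists>P. orthogonal_polys x0 x1 W P \<and>
      (\<forall>n. \<exists>\<Lambda>. diffop_act (P n) D = const_mat \<Lambda> ** P n)}"

definition darboux_transformation ::
  "ereal \<Rightarrow> ereal \<Rightarrow> (real \<Rightarrow> complex ^ 'n ^ 'n::finite) \<Rightarrow> (nat \<Rightarrow> 'n matpoly)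
    \<Rightarrow> (nat \<Rightarrow> 'n matpoly) \<Rightarrow> bool" where
  "darboux_transformation x0 x1 W P Pt \<longleftrightarrow>
    (\<exists>D \<in> weight_algebra x0 x1 W. \<exists>V N.
      D = diffop_mult V N \<and> degree_preserving V \<and> degree_preserving N \<and>
      (\<exists>A. \<forall>n. diffop_act (P n) V = const_mat (A n) ** Pt n))"

end

theory Submission
  imports Defs
begin

text \<open>
  An intertwining \<open>P\<^sub>n \<cdot> V = A\<^sub>n Pt\<^sub>n\<close> has an adjoint \<open>T\<close> on matrix polynomials, defined by
  \<open>\<langle>T Q, F\<rangle>\<^sub>W = \<langle>Q, F \<cdot> V\<rangle>\<^sub>W\<^sub>t\<close>; it sends \<open>Pt\<^sub>n\<close> to \<open>B\<^sub>n P\<^sub>n\<close> with \<open>B\<^sub>n\<close> invertible exactly when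
  \<open>A\<^sub>n\<close> is.  Multiplication by \<open>x\<close> is symmetric for both inner products, so the iterated
  commutators of \<open>T\<close> with \<open>x\<close> vanish as soon as those of \<open>V\<close> do; hence \<open>T\<close> is the action of a
  differential operator \<open>N\<close>, and \<open>VN\<close> has the \<open>P\<^sub>n\<close> as eigenfunctions.  The determinant of the
  leading coefficient of \<open>x\<^sup>n \<cdot> V\<close> is a polynomial in \<open>n\<close>, so if one \<open>A\<^sub>n\<close> is invertible, then all but
  finitely many are, which makes \<open>V\<close> and \<open>N\<close> degree-preserving.
\<close>

section \<open>Coefficients and degrees of matrix polynomials\<close>

lemma mat_coeff_nth: "mat_coeff P k $ i $ j = coeff (P $ i $ j) k"
  by (simp add: mat_coeff_def)

lemma matpoly_eqI: "(\<And>k. mat_coeff P k = mat_coeff Q k) \<Longrightarrow> P = Q"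
  by (simp add: vec_eq_iff mat_coeff_nth poly_eq_iff)

lemma mat_coeff_0 [simp]: "mat_coeff 0 k = 0"
  by (simp add: vec_eq_iff mat_coeff_nth)

lemma mat_coeff_add: "mat_coeff (P + Q) k = mat_coeff P k + mat_coeff Q k"
  by (simp add: vec_eq_iff mat_coeff_nth)

lemma mat_coeff_diff: "mat_coeff (P - Q) k = mat_coeff P k - mat_coeff Q k"
  by (simp add: vec_eq_iff mat_coeff_nth)

lemma mat_coeff_sum: "mat_coeff (\<Sum>i\<in>I. f i) k = (\<Sum>i\<in>I. mat_coeff (f i) k)"
  by (simp add: vec_eq_iff mat_coeff_nth coeff_sum)

lemma mat_coeff_const_mult: "mat_coeff (const_mat A ** P) k = A ** mat_coeff P k"
  by (simp add: vec_eq_iff mat_coeff_nth const_mat_def matrix_matrix_mult_def coeff_sum)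

lemma mat_degree_le_iff: "mat_degree P \<le> m \<longleftrightarrow> (\<forall>k>m. mat_coeff P k = 0)"
proof -
  have "{degree (P $ i $ j) |i j. True} = (\<lambda>(i, j). degree (P $ i $ j)) ` UNIV"
    by auto
  then have "mat_degree P \<le> m \<longleftrightarrow> (\<forall>i j. degree (P $ i $ j) \<le> m)"
    by (simp add: mat_degree_def)
  also have "\<dots> \<longleftrightarrow> (\<forall>k>m. mat_coeff P k = 0)"
    by (simp add: vec_eq_iff mat_coeff_nth) (meson coeff_eq_0 degree_le le_less_trans)
  finally show ?thesis .
qed

lemma mat_coeff_eq_0: "mat_degree P < k \<Longrightarrow> mat_coeff P k = 0"
  using mat_degree_le_iff by blast

text \<open>If the coefficient at \<open>n\<close> vanished, the degree would be at most
  \<open>n - 1\<close>. The index 0 is excluded because the zero matrix also has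
  \<open>mat_degree\<close> 0.\<close>

lemma mat_coeff_degree_neq_0:
  "mat_degree P = n \<Longrightarrow> 0 < n \<Longrightarrow> mat_coeff P n \<noteq> 0"
proof
  assume *: "mat_degree P = n" "0 < n" "mat_coeff P n = 0"
  then have "mat_coeff P k = 0" if "k > n - 1" for k
    using that mat_coeff_eq_0[of P k] by (cases "k = n") auto
  then have "mat_degree P \<le> n - 1"
    by (simp add: mat_degree_le_iff)
  with * show False by simp
qed

lemma mat_degree_eqI:
  assumes "mat_degree P \<le> n" "mat_coeff P n \<noteq> 0"
  shows "mat_degree P = n"
  using assms mat_coeff_eq_0[of P n] by (meson le_neq_implies_less)

lemma const_mat_mult: "const_mat A ** const_mat B = const_mat (A ** B)"
  by (rule matpoly_eqI) (simp add: mat_coeff_const_mult,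
    simp add: vec_eq_iff mat_coeff_nth matrix_matrix_mult_def const_mat_def coeff_pCons split: nat.split)

lemma const_mat_0 [simp]: "const_mat 0 = 0"
  by (simp add: vec_eq_iff const_mat_def)

section \<open>Matrix algebra and invertibility\<close>

lemma mat_mult_0 [simp]:
  fixes A :: "'a::semiring_1 ^ 'n ^ 'n::finite"
  shows "A ** 0 = 0" "0 ** A = 0"
  by (simp_all add: vec_eq_iff matrix_matrix_mult_def)

lemma mat_mult_add_rdistrib: "(A + B) ** C = A ** C + B ** C"
  for A :: "'a::semiring_1 ^ 'n ^ 'n::finite"
  by (simp add: vec_eq_iff matrix_matrix_mult_def distrib_right sum.distrib)

lemma mat_mult_sum_right: "A ** (\<Sum>i\<in>I. f i) = (\<Sum>i\<in>I. A ** f i)"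
  for A :: "'a::semiring_1 ^ 'n ^ 'n::finite"
  by (induction I rule: infinite_finite_induct) (simp_all add: matrix_add_ldistrib)

lemma mat_mult_diff_right: "A ** (B - C) = A ** B - A ** C"
  for A :: "'a::ring_1 ^ 'n ^ 'n::finite"
  by (simp add: vec_eq_iff matrix_matrix_mult_def right_diff_distrib sum_subtractf)

lemma mat_mult_inverse_cancel:
  fixes A :: "'a::semiring_1 ^ 'n ^ 'n::finite"
  assumes "invertible A"
  shows "B ** matrix_inv A ** A = B" "B ** A ** matrix_inv A = B"
proof -
  have "A ** matrix_inv A = mat 1 \<and> matrix_inv A ** A = mat 1"
    using assms unfolding invertible_def matrix_inv_def by (rule someI_ex)
  then show "B ** matrix_inv A ** A = B" "B ** A ** matrix_inv A = B"
    by (simp_all flip: matrix_mul_assoc)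
qed

lemma mult_invertible_eq_0_iff:
  fixes A :: "'a::semiring_1 ^ 'n ^ 'n::finite"
  assumes "invertible A"
  shows "B ** A = 0 \<longleftrightarrow> B = 0"
  using mat_mult_inverse_cancel(2)[OF assms, of B] by auto

lemma invertible_matrix_inv: "invertible A \<Longrightarrow> invertible (matrix_inv A)"
  for A :: "'a::semiring_1 ^ 'n ^ 'n::finite"
  using mat_mult_inverse_cancel[of A "mat 1"] unfolding invertible_def by (metis matrix_mul_lid)

text \<open>A null vector of the transpose is a left null row of \<open>A\<close>; repeating it in
  every row gives a square matrix, which \<open>const_mat\<close> can turn into a left
  multiplier.\<close>

lemma not_invertible_left_kernel:
  fixes A :: "'a::field ^ 'n ^ 'n::finite"
  assumes "\<not> invertible A"
  obtains B :: "'a ^ 'n ^ 'n" where "B \<noteq> 0" "B ** A = 0"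
proof -
  have "\<not> invertible (transpose A)"
    using assms by (simp add: invertible_det_nz)
  then obtain v where v: "v \<noteq> 0" "transpose A *v v = 0"
    by (auto simp: invertible_left_inverse matrix_left_invertible_ker)
  define B :: "'a ^ 'n ^ 'n" where "B = (\<chi> i. v)"
  have "B \<noteq> 0" using v(1) by (auto simp: B_def vec_eq_iff)
  moreover have "B ** A = 0"
    using v(2) by (simp add: B_def vec_eq_iff matrix_matrix_mult_def matrix_vector_mult_def
        transpose_def mult.commute)
  ultimately show thesis using that by blast
qed

section \<open>Bases of matrix polynomials\<close>

text \<open>The weight-free part of \<open>orthogonal_polys\<close>: a basis of the matrix
  polynomials as a left module over the constant matrices. The powers of x are another
  instance.\<close>

definition degree_basis :: "(nat \<Rightarrow> 'n::finite matpoly) \<Rightarrow> bool" where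
  "degree_basis P \<longleftrightarrow> (\<forall>n. mat_degree (P n) = n \<and> invertible (mat_coeff (P n) n))"

lemma degree_basisD:
  assumes "degree_basis P"
  shows "mat_degree (P n) = n" "invertible (mat_coeff (P n) n)"
  using assms by (simp_all add: degree_basis_def)

lemma degree_basis_expansion:
  assumes "degree_basis P" "mat_degree Q \<le> m"
  obtains C where "Q = (\<Sum>k\<le>m. const_mat (C k) ** P k)"
proof -
  \<comment> \<open>A strict bound on the indices lets the induction start at the zero polynomial,
    which \<open>mat_degree\<close> does not tell apart from a nonzero constant.\<close>
  have "\<exists>C. Q = (\<Sum>k<m. const_mat (C k) ** P k)" if "\<And>k. k \<ge> m \<Longrightarrow> mat_coeff Q k = 0" for m
    using that
  proof (induction m arbitrary: Q)
    case 0
    then show ?case by (auto intro: matpoly_eqI)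
  next
    case (Suc m)
    \<comment> \<open>The constant that makes \<open>const_mat ?c ** P m\<close> agree with
      \<open>Q\<close> at index \<open>m\<close>; subtracting that term lowers the bound by
      one.\<close>
    let ?c = "mat_coeff Q m ** matrix_inv (mat_coeff (P m) m)"
    have "mat_coeff (Q - const_mat ?c ** P m) k = 0" if "k \<ge> m" for k
    proof (cases "k = m")
      case True
      then show ?thesis
        using degree_basisD[OF assms(1)]
        by (simp add: mat_coeff_diff mat_coeff_const_mult mat_mult_inverse_cancel)
    next
      case False
      then show ?thesis
        using degree_basisD[OF assms(1)] that Suc.prems[of k]
        by (simp add: mat_coeff_diff mat_coeff_const_mult mat_coeff_eq_0)
    qed
    from Suc.IH[OF this] obtain C where
      C: "Q - const_mat ?c ** P m = (\<Sum>k<m. const_mat (C k) ** P k)" by blast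
    have "Q = (\<Sum>k<Suc m. const_mat ((C(m := ?c)) k) ** P k)"
      using C by (simp add: algebra_simps)
    then show ?case by blast
  qed
  from this[of "Suc m"] assms(2) show thesis
    by (auto simp: mat_degree_le_iff Suc_le_eq lessThan_Suc_atMost intro: that)
qed

section \<open>Differential operators\<close>

definition mat_shift :: "'n::finite matpoly \<Rightarrow> 'n matpoly" where
  "mat_shift P = map_matrix (\<lambda>p. [:0, 1:] * p) P"

lemma nth_mat_shift: "mat_shift P $ i $ j = [:0, 1:] * (P $ i $ j)"
  by (simp add: mat_shift_def)

lemma mat_shift_add: "mat_shift (P + Q) = mat_shift P + mat_shift Q"
  by (simp add: mat_shift_def vec_eq_iff)

lemma mat_shift_0 [simp]: "mat_shift 0 = 0"
  by (simp add: mat_shift_def vec_eq_iff)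

lemma mat_shift_mult_left: "mat_shift P ** Q = mat_shift (P ** Q)"
  unfolding mat_shift_def by (rule map_matrix_mult_left)

lemma mat_shift_mult_right: "P ** mat_shift Q = mat_shift (P ** Q)"
  unfolding mat_shift_def by (rule map_matrix_mult_right)

lemma mat_shift_sum: "mat_shift (\<Sum>i\<in>I. f i) = (\<Sum>i\<in>I. mat_shift (f i))"
  by (induction I rule: infinite_finite_induct) (simp_all add: mat_shift_add)

definition mat_monom :: "nat \<Rightarrow> 'n::finite matpoly" where
  "mat_monom n = map_matrix (\<lambda>c. monom c n) (mat 1)"

lemma nth_mat_monom: "mat_monom n $ i $ j = (if i = j then monom 1 n else 0)"
  by (simp add: mat_monom_def mat_def)

lemma mat_shift_mat_monom: "mat_shift (mat_monom n) = mat_monom (Suc n)"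
  by (simp add: vec_eq_iff mat_shift_def nth_mat_monom monom_Suc)

lemma mat_coeff_mat_monom: "mat_coeff (mat_monom n) k = (if k = n then mat 1 else 0)"
  by (simp add: vec_eq_iff mat_coeff_nth nth_mat_monom mat_def)

lemma degree_basis_mat_monom: "degree_basis (mat_monom :: nat \<Rightarrow> 'n::finite matpoly)"
proof -
  have "mat_degree (mat_monom n :: 'n matpoly) = n" for n
  proof (rule mat_degree_eqI)
    have "(mat 1 :: complex ^ 'n ^ 'n) $ i $ i \<noteq> 0" for i
      by (simp add: mat_def)
    then show "mat_coeff (mat_monom n :: 'n matpoly) n \<noteq> 0"
      by (metis mat_coeff_mat_monom zero_index)
  qed (simp add: mat_degree_le_iff mat_coeff_mat_monom)
  moreover have "invertible (mat 1 :: complex ^ 'n ^ 'n)"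
    unfolding invertible_def by (metis matrix_mul_lid)
  ultimately show ?thesis
    by (simp add: degree_basis_def mat_coeff_mat_monom)
qed

text \<open>Operators act on the right, so constants pass through on the left. A left-linear map is
  determined by its values on a \<open>degree_basis\<close>.\<close>

definition left_linear :: "('n::finite matpoly \<Rightarrow> 'n matpoly) \<Rightarrow> bool" where
  "left_linear T \<longleftrightarrow> (\<forall>P Q. T (P + Q) = T P + T Q) \<and>
    (\<forall>A P. T (const_mat A ** P) = const_mat A ** T P)"

lemma left_linearD:
  assumes "left_linear T"
  shows "T (P + Q) = T P + T Q" "T (const_mat A ** P) = const_mat A ** T P"
  using assms by (simp_all add: left_linear_def)

lemma left_linear_0: "left_linear T \<Longrightarrow> T 0 = 0"
  using left_linearD(1)[of T 0 0] by simp

lemma left_linear_sum: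
  "left_linear T \<Longrightarrow> T (\<Sum>i\<in>I. f i) = (\<Sum>i\<in>I. T (f i))"
  by (induction I rule: infinite_finite_induct) (simp_all add: left_linearD left_linear_0)

lemma left_linear_diff:
  "left_linear S \<Longrightarrow> left_linear T \<Longrightarrow> left_linear (\<lambda>P. S P - T P)"
  by (simp add: left_linear_def mat_mult_diff_right)

lemma mat_pderiv_pow_const_mult: "(mat_pderiv ^^ n) (const_mat A ** P) = const_mat A ** (mat_pderiv ^^ n) P"
  by (simp add: vec_eq_iff nth_mat_pderiv_pow matrix_matrix_mult_def const_mat_def
      higher_pderiv_sum higher_pderiv_smult)

lemma mat_pderiv_pow_add_distrib: "(mat_pderiv ^^ n) (P + Q) = (mat_pderiv ^^ n) P + (mat_pderiv ^^ n) Q"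
  by (simp add: vec_eq_iff nth_mat_pderiv_pow higher_pderiv_add)

lemma left_linear_diffop_act: "left_linear (\<lambda>P. diffop_act P D)"
  by (simp add: left_linear_def diffop_act_def mat_pderiv_pow_add_distrib mat_pderiv_pow_const_mult
      mat_mult_add_rdistrib sum.distrib mat_mult_sum_right flip: matrix_mul_assoc)

section \<open>Iterated commutators with multiplication by x\<close>

definition shift_ad :: "('n::finite matpoly \<Rightarrow> 'n matpoly) \<Rightarrow> 'n matpoly \<Rightarrow> 'n matpoly" where
  "shift_ad T P = T (mat_shift P) - mat_shift (T P)"

lemma left_linear_shift_ad: "left_linear T \<Longrightarrow> left_linear (shift_ad T)"
  unfolding shift_ad_def
  by (rule left_linear_diff)
     (simp_all add: left_linear_def mat_shift_add flip: mat_shift_mult_right)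

lemma shift_ad_zero: "(shift_ad ^^ m) (\<lambda>_. 0) = (\<lambda>_. 0)"
  by (induction m) (simp_all add: shift_ad_def fun_eq_iff)

lemma shift_ad_pow_zero_mono:
  "(shift_ad ^^ m) T = (\<lambda>_. 0) \<Longrightarrow> m \<le> n \<Longrightarrow> (shift_ad ^^ n) T = (\<lambda>_. 0)"
  by (auto simp: le_iff_add add.commute[of m] funpow_add shift_ad_zero)

lemma shift_ad_pow_sum:
  "(shift_ad ^^ m) (\<lambda>P. \<Sum>i\<in>I. T i P) = (\<lambda>P. \<Sum>i\<in>I. (shift_ad ^^ m) (T i) P)"
  by (induction m) (simp_all add: shift_ad_def fun_eq_iff mat_shift_sum sum_subtractf)

lemma shift_ad_pow_diff:
  "(shift_ad ^^ m) (\<lambda>P. S P - T P) = (\<lambda>P. (shift_ad ^^ m) S P - (shift_ad ^^ m) T P)"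
proof -
  have "mat_shift (P - Q) = mat_shift P - mat_shift Q" for P Q :: "'a matpoly"
    by (simp add: mat_shift_def vec_eq_iff)
  then show ?thesis
    by (induction m) (simp_all add: shift_ad_def fun_eq_iff)
qed

text \<open>Each differentiation adds one more copy of the lower derivative of \<open>p\<close>,
  coming from the factor x. Writing the order as \<open>Suc k\<close> avoids a truncated
  subtraction.\<close>

lemma higher_pderiv_shift:
  fixes p :: "complex poly"
  shows "(pderiv ^^ Suc k) ([:0, 1:] * p) = [:0, 1:] * (pderiv ^^ Suc k) p + [:of_nat (Suc k):] * (pderiv ^^ k) p"
proof (induction k)
  case 0
  then show ?case by (simp add: pderiv_mult pderiv_pCons)
next
  case (Suc k)
  have "(pderiv ^^ Suc (Suc k)) ([:0, 1:] * p) = pderiv ((pderiv ^^ Suc k) ([:0, 1:] * p))" by simp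
  also have "\<dots> = [:0, 1:] * (pderiv ^^ Suc (Suc k)) p + [:of_nat (Suc (Suc k)):] * (pderiv ^^ Suc k) p"
    unfolding Suc.IH
    using smult_add_left[of 1 "1 + of_nat k" "(pderiv ^^ Suc k) p"]
    by (simp add: pderiv_add pderiv_pCons pderiv_smult algebra_simps)
  finally show ?case .
qed

text \<open>A commutator with x lowers the order by one and multiplies \<open>F\<close> by the old
  order, so \<open>F\<close> varies in the induction. After \<open>k\<close> steps a right
  multiplication is left; it commutes with x, which accounts for the last of the
  \<open>Suc k\<close> steps.\<close>

lemma shift_ad_pow_monom:
  "(shift_ad ^^ Suc k) (\<lambda>P. (mat_pderiv ^^ k) P ** F) = (\<lambda>_. 0)"
proof (induction k arbitrary: F)
  case 0
  then show ?case by (simp add: shift_ad_def fun_eq_iff mat_shift_mult_left)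
next
  case (Suc k)
  have "(mat_pderiv ^^ Suc k) (mat_shift P) ** F = mat_shift ((mat_pderiv ^^ Suc k) P ** F)
      + (mat_pderiv ^^ k) P ** map_matrix (\<lambda>p. [:of_nat (Suc k):] * p) F" for P
  proof -
    have "(mat_pderiv ^^ Suc k) (mat_shift P) = mat_shift ((mat_pderiv ^^ Suc k) P)
        + map_matrix (\<lambda>p. [:of_nat (Suc k):] * p) ((mat_pderiv ^^ k) P)"
      unfolding vec_eq_iff vector_add_component nth_mat_pderiv_pow nth_mat_shift higher_pderiv_shift
      by (simp add: nth_mat_pderiv_pow del: funpow.simps of_nat_Suc)
    then show ?thesis
      by (simp only: mat_mult_add_rdistrib mat_shift_mult_left map_matrix_mult_left map_matrix_mult_right)
  qed
  then have "shift_ad (\<lambda>P. (mat_pderiv ^^ Suc k) P ** F) =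
      (\<lambda>P. (mat_pderiv ^^ k) P ** map_matrix (\<lambda>p. [:of_nat (Suc k):] * p) F)"
    unfolding shift_ad_def by simp
  then show ?case
    unfolding funpow_Suc_right[of "Suc k"] comp_apply using Suc.IH by simp
qed

lemma shift_ad_pow_diffop_act:
  assumes "degree D < m"
  shows "(shift_ad ^^ m) (\<lambda>P. diffop_act P D) = (\<lambda>_. 0)"
proof -
  have "(shift_ad ^^ m) (\<lambda>P. (mat_pderiv ^^ i) P ** coeff D i) = (\<lambda>_. 0)" if "i \<le> degree D" for i
    by (rule shift_ad_pow_zero_mono[OF shift_ad_pow_monom]) (use that assms in simp)
  then show ?thesis
    by (simp add: diffop_act_def shift_ad_pow_sum)
qed

text \<open>By induction \<open>shift_ad T\<close> vanishes, since its value at a power of x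
  involves \<open>T\<close> only at that power and the next. So \<open>T\<close> commutes with x,
  and its vanishing at 1 spreads to all powers and then, by left linearity, to all
  polynomials.\<close>

lemma shift_ad_pow_zero_imp_zero:
  assumes "left_linear T" "(shift_ad ^^ m) T = (\<lambda>_. 0)" "\<And>i. i < m \<Longrightarrow> T (mat_monom i) = 0"
  shows "T P = 0"
proof -
  have "T = (\<lambda>_. 0)"
    using assms
  proof (induction m arbitrary: T)
    case (Suc m)
    have "shift_ad T = (\<lambda>_. 0)"
    proof (rule Suc.IH)
      show "left_linear (shift_ad T)"
        by (rule left_linear_shift_ad) fact
      show "(shift_ad ^^ m) (shift_ad T) = (\<lambda>_. 0)"
        using Suc.prems(2) by (simp add: funpow_swap1)
      show "shift_ad T (mat_monom i) = 0" if "i < m" for i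
        using Suc.prems(3)[of i] Suc.prems(3)[of "Suc i"] that
        by (simp add: shift_ad_def mat_shift_mat_monom)
    qed
    then have shift: "T (mat_shift P) = mat_shift (T P)" for P
      by (metis eq_iff_diff_eq_0 shift_ad_def)
    have "T (mat_monom i) = 0" for i
    proof (induction i)
      case (Suc i)
      then show ?case using shift[of "mat_monom i"] by (simp add: mat_shift_mat_monom)
    qed (use Suc.prems(3)[of 0] in simp)
    then show ?case
      using degree_basis_expansion[OF degree_basis_mat_monom order_refl]
      by (metis (no_types, lifting) Suc.prems(1) left_linearD(2) left_linear_sum mat_mult_0(1) sum.neutral)
  qed simp
  then show ?thesis by simp
qed

section \<open>Falling factorials and interpolation on powers of x\<close>

definition falling_poly :: "nat \<Rightarrow> complex poly" where
  "falling_poly i = (\<Prod>l<i. [:- of_nat l, 1:])"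

lemma poly_falling_poly: "poly (falling_poly i) x = (\<Prod>l<i. x - of_nat l)"
  by (simp add: falling_poly_def poly_prod)

lemma poly_falling_poly_eq_0: "n < i \<Longrightarrow> poly (falling_poly i) (of_nat n) = 0"
  by (auto simp: poly_falling_poly)

lemma poly_falling_poly_neq_0: "poly (falling_poly n) (of_nat n) \<noteq> 0"
  by (auto simp: poly_falling_poly)

text \<open>The scalar n(n-1)...(n-i+1) is zero for \<open>i > n\<close>, which makes the truncated
  \<open>n - i\<close> harmless. It is written as a polynomial value because its dependence on
  \<open>n\<close> matters in \<open>leading_coeff_polynomial\<close>.\<close>

lemma higher_pderiv_monom_falling:
  "(pderiv ^^ i) (monom 1 n) = smult (poly (falling_poly i) (of_nat n)) (monom 1 (n - i))"
proof (induction i)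
  case (Suc i)
  show ?case
  proof (cases "i < n")
    case True
    then show ?thesis
      by (simp add: Suc.IH pderiv_smult pderiv_monom smult_monom poly_falling_poly of_nat_diff)
  next
    case False
    then show ?thesis
      by (simp add: Suc.IH pderiv_smult pderiv_monom smult_monom poly_falling_poly_eq_0)
  qed
qed (simp add: falling_poly_def)

lemma mat_pderiv_pow_mat_monom:
  "(mat_pderiv ^^ i) (mat_monom n) = map_matrix (smult (poly (falling_poly i) (of_nat n))) (mat_monom (n - i))"
  by (simp add: vec_eq_iff nth_mat_pderiv_pow nth_mat_monom higher_pderiv_monom_falling)

lemma mat_monom_0: "mat_monom 0 = mat 1"
  by (simp add: vec_eq_iff nth_mat_monom mat_def)

lemma map_matrix_smult_0: "map_matrix (smult 0) (P :: 'n::finite matpoly) = 0"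
  by (simp add: vec_eq_iff)

lemma map_matrix_smult_mult:
  "map_matrix (smult c) P ** Q = map_matrix (smult c) (P ** (Q :: 'n::finite matpoly))"
  using map_matrix_mult_left[of "[:c:]" P Q] by simp

text \<open>The system is triangular: a term of order \<open>Suc m\<close> annihilates the lower
  powers of x, so the values already fixed survive its addition.\<close>

lemma diffop_interpolation:
  obtains D where "degree D \<le> m" "\<And>i. i \<le> m \<Longrightarrow> diffop_act (mat_monom i) D = R i"
proof -
  have "\<exists>D. degree D \<le> m \<and> (\<forall>i\<le>m. diffop_act (mat_monom i) D = R i)"
  proof (induction m)
    case 0
    have "diffop_act (mat_monom 0) (monom (R 0) 0) = R 0"
      by (simp add: diffop_act_monom mat_monom_0)
    then show ?case by (metis degree_monom_le le_zero_eq)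
  next
    case (Suc m)
    then obtain D where D: "degree D \<le> m" "\<And>i. i \<le> m \<Longrightarrow> diffop_act (mat_monom i) D = R i"
      by blast
    \<comment> \<open>\<open>c\<close> is the factorial of \<open>Suc m\<close>, and
      \<open>F\<close> is the remaining error at the new power divided by it.\<close>
    define c where "c = poly (falling_poly (Suc m)) (of_nat (Suc m))"
    define F where "F = map_matrix (smult (1 / c)) (R (Suc m) - diffop_act (mat_monom (Suc m)) D)"
    have "diffop_act (mat_monom i) (monom F (Suc m)) = 0" if "i < Suc m" for i
      using poly_falling_poly_eq_0[OF that]
      by (simp add: diffop_act_monom mat_pderiv_pow_mat_monom map_matrix_smult_0 del: funpow.simps)
    moreover have "diffop_act (mat_monom (Suc m)) (monom F (Suc m)) =
        R (Suc m) - diffop_act (mat_monom (Suc m)) D"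
      using poly_falling_poly_neq_0[of "Suc m"]
      by (simp add: diffop_act_monom mat_pderiv_pow_mat_monom F_def c_def mat_monom_0
          map_matrix_smult_mult del: funpow.simps) (simp add: vec_eq_iff)
    ultimately have "\<forall>i\<le>Suc m. diffop_act (mat_monom i) (D + monom F (Suc m)) = R i"
      using D by (auto simp: diffop_act_add le_Suc_eq)
    moreover have "degree (D + monom F (Suc m)) \<le> Suc m"
      using D by (intro degree_add_le degree_monom_le) auto
    ultimately show ?case by blast
  qed
  then show thesis using that by blast
qed

text \<open>Converse of \<open>shift_ad_pow_diffop_act\<close>: an operator that interpolates
  \<open>T\<close> at low powers of x differs from \<open>T\<close> by a map covered by
  \<open>shift_ad_pow_zero_imp_zero\<close>.\<close>

lemma diffop_of_shift_ad:
  assumes "left_linear T" "(shift_ad ^^ m) T = (\<lambda>_. 0)"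
  obtains D where "\<And>P. diffop_act P D = T P"
proof -
  obtain D where D: "degree D \<le> m" "\<And>i. i \<le> m \<Longrightarrow> diffop_act (mat_monom i) D = T (mat_monom i)"
    using diffop_interpolation[of m "\<lambda>i. T (mat_monom i)"] by metis
  have "T P - diffop_act P D = 0" for P
  \<comment> \<open>\<open>D\<close> may have order \<open>m\<close>, so \<open>Suc m\<close>
    commutators are taken and agreement is required up to the power \<open>m\<close>.\<close>
  proof (rule shift_ad_pow_zero_imp_zero[where T = "\<lambda>P. T P - diffop_act P D" and m = "Suc m"])
    show "left_linear (\<lambda>P. T P - diffop_act P D)"
      by (intro left_linear_diff assms left_linear_diffop_act)
    show "(shift_ad ^^ Suc m) (\<lambda>P. T P - diffop_act P D) = (\<lambda>_. 0)"
      using shift_ad_pow_zero_mono[OF assms(2), of "Suc m"] shift_ad_pow_diffop_act[of D "Suc m"] D(1)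
      by (simp add: shift_ad_pow_diff del: funpow.simps)
  qed (use D in simp)
  then show thesis using that by (metis eq_iff_diff_eq_0)
qed

section \<open>Degree-preserving operators\<close>

text \<open>Only the term of index \<open>n\<close> in the expansion of \<open>f\<close> reaches
  degree \<open>n\<close>, before and after applying \<open>E\<close>. Its coefficient
  \<open>C\<close> links the two top coefficients.\<close>

lemma diffop_act_degree_basis:
  assumes "degree_basis P" "degree_basis Q" "\<And>n. diffop_act (P n) E = const_mat (A n) ** Q n"
    "mat_degree f \<le> n"
  obtains C where "mat_coeff f n = C ** mat_coeff (P n) n" "mat_degree (diffop_act f E) \<le> n"
    "mat_coeff (diffop_act f E) n = C ** A n ** mat_coeff (Q n) n"
proof -
  obtain C where C: "f = (\<Sum>k\<le>n. const_mat (C k) ** P k)"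
    using degree_basis_expansion assms(1,4) by blast
  have fE: "diffop_act f E = (\<Sum>k\<le>n. const_mat (C k) ** const_mat (A k) ** Q k)"
    by (simp add: C left_linear_sum[OF left_linear_diffop_act] left_linearD[OF left_linear_diffop_act]
        assms(3) flip: matrix_mul_assoc)
  have top: "mat_coeff (\<Sum>k\<le>n. const_mat (X k) ** R k) n = X n ** mat_coeff (R n) n"
    if "degree_basis R" for X R
  proof -
    have "(\<Sum>k<n. X k ** mat_coeff (R k) n) = 0"
      using degree_basisD[OF that] by (intro sum.neutral) (simp add: mat_coeff_eq_0)
    then show ?thesis
      by (simp add: mat_coeff_add mat_coeff_sum mat_coeff_const_mult flip: lessThan_Suc_atMost)
  qed
  show thesis
  proof (rule that[of "C n"])
    show "mat_coeff f n = C n ** mat_coeff (P n) n"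
      unfolding C by (rule top) fact
    show "mat_coeff (diffop_act f E) n = C n ** A n ** mat_coeff (Q n) n"
      unfolding fE const_mat_mult by (rule top) fact
    show "mat_degree (diffop_act f E) \<le> n"
      using degree_basisD[OF assms(2)] unfolding fE const_mat_mult
      by (auto simp: mat_degree_le_iff mat_coeff_sum mat_coeff_const_mult mat_coeff_eq_0 intro!: sum.neutral)
  qed
qed

text \<open>The term of order \<open>i\<close> removes \<open>i\<close> powers of x, so only the
  coefficient at \<open>i\<close> of its matrix polynomial restores degree \<open>n\<close>. It
  enters with a falling factorial, a polynomial in \<open>n\<close>.\<close>

lemma leading_coeff_polynomial:
  obtains M where "\<And>n. mat_coeff (diffop_act (mat_monom n) E) n = map_matrix (\<lambda>q. poly q (of_nat n)) M"
proof -
  define M where "M = (\<chi> a b. \<Sum>i\<le>degree E. smult (coeff (coeff E i $ a $ b) i) (falling_poly i))"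
  have "mat_coeff (diffop_act (mat_monom n) E) n $ a $ b = poly (M $ a $ b) (of_nat n)" for n a b
  proof -
    have "coeff (((mat_pderiv ^^ i) (mat_monom n) ** F) $ a $ b) n =
        coeff (F $ a $ b) i * poly (falling_poly i) (of_nat n)" for i and F :: "'a matpoly"
    proof -
      have "((mat_pderiv ^^ i) (mat_monom n) ** F) $ a $ b =
          (\<Sum>c\<in>UNIV. if c = a then (pderiv ^^ i) (monom 1 n) * F $ a $ b else 0)"
        by (simp only: matrix_matrix_mult_def vec_lambda_beta)
           (rule sum.cong, auto simp: nth_mat_pderiv_pow nth_mat_monom)
      also have "\<dots> = smult (poly (falling_poly i) (of_nat n)) (monom 1 (n - i) * F $ a $ b)"
        by (simp add: higher_pderiv_monom_falling)
      \<comment> \<open>For \<open>i > n\<close> the exponent \<open>n - i\<close> is truncated to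
        0, but the falling factorial vanishes there.\<close>
      finally show ?thesis
        by (cases "i \<le> n") (simp_all add: coeff_monom_mult poly_falling_poly_eq_0 not_le)
    qed
    then show ?thesis
      by (simp add: mat_coeff_nth diffop_act_def coeff_sum M_def poly_sum)
  qed
  then show thesis using that[of M] by (simp add: vec_eq_iff)
qed

lemma poly_det: "poly (det M) x = det (map_matrix (\<lambda>q. poly q x) M)"
  for M :: "complex poly ^ 'n ^ 'n::finite"
  by (simp add: det_def poly_sum poly_prod)

text \<open>Up to nonzero factors, the determinant of \<open>A n\<close> is the value at
  \<open>n\<close> of the fixed polynomial \<open>det M\<close>. One invertible \<open>A m\<close>
  makes \<open>det M\<close> nonzero, leaving finitely many roots.\<close>

lemma finite_not_invertible:
  assumes "degree_basis P" "degree_basis Q" "\<And>n. diffop_act (P n) E = const_mat (A n) ** Q n"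
    "invertible (A m)"
  shows "finite {n. \<not> invertible (A n)}"
proof -
  obtain M where M: "\<And>n. mat_coeff (diffop_act (mat_monom n) E) n = map_matrix (\<lambda>q. poly q (of_nat n)) M"
    using leading_coeff_polynomial[of E] by blast
  have iff: "invertible (A n) \<longleftrightarrow> poly (det M) (of_nat n) \<noteq> 0" for n
  proof -
    \<comment> \<open>For the monic polynomial \<open>mat_monom n\<close>, the factor
      \<open>C\<close> is a left inverse of the leading coefficient of \<open>P n\<close>.\<close>
    obtain C where C: "mat 1 = C ** mat_coeff (P n) n"
      "map_matrix (\<lambda>q. poly q (of_nat n)) M = C ** A n ** mat_coeff (Q n) n"
      using diffop_act_degree_basis[OF assms(1-3), of "mat_monom n" n]
        degree_basisD[OF degree_basis_mat_monom, of n]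
      by (metis M mat_coeff_mat_monom order_refl)
    have "det C \<noteq> 0"
      using arg_cong[OF C(1), of det] by (auto simp: det_mul)
    moreover have "det (mat_coeff (Q n) n) \<noteq> 0"
      using degree_basisD[OF assms(2)] by (simp add: invertible_det_nz)
    ultimately show ?thesis
      by (simp add: poly_det C(2) det_mul invertible_det_nz)
  qed
  have "det M \<noteq> 0"
    using iff assms(4) by force
  then have "finite (of_nat -` {x. poly (det M) x = 0} :: nat set)"
    by (intro finite_vimageI poly_roots_finite) (auto simp: inj_def)
  then show ?thesis
    by (rule finite_subset[rotated]) (auto simp: iff)
qed

text \<open>The new top coefficient is \<open>C ** A n\<close> times an invertible matrix, with
  \<open>C\<close> nonzero because \<open>f\<close> has degree \<open>n > 0\<close>. Invertibility
  of \<open>A n\<close> keeps the product nonzero.\<close>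

lemma degree_preserving_of_invertible:
  assumes "degree_basis P" "degree_basis Q" "\<And>n. diffop_act (P n) E = const_mat (A n) ** Q n"
    "invertible (A m)"
  shows "degree_preserving E"
proof -
  have "mat_degree (diffop_act f E) = n" if A: "invertible (A n)" and f: "mat_degree f = n" and "n > 0" for n f
  proof -
    obtain C where C: "mat_coeff f n = C ** mat_coeff (P n) n" "mat_degree (diffop_act f E) \<le> n"
      "mat_coeff (diffop_act f E) n = C ** A n ** mat_coeff (Q n) n"
      using diffop_act_degree_basis[OF assms(1-3)] f by blast
    have "C \<noteq> 0"
      using C(1) mat_coeff_degree_neq_0[OF f \<open>n > 0\<close>] by auto
    then show ?thesis
      using C(3) A degree_basisD[OF assms(2)]
      by (intro mat_degree_eqI C(2)) (simp add: mult_invertible_eq_0_iff)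
  qed
  then have "{n. \<not> (\<forall>f. mat_degree f = n \<longrightarrow> mat_degree (diffop_act f E) = n)} \<subseteq>
      insert 0 {n. \<not> invertible (A n)}"
    by auto
  then show ?thesis
    unfolding degree_preserving_def
    using finite_not_invertible[OF assms] by (meson finite_insert finite_subset)
qed

text \<open>If \<open>A n\<close> is singular, a nonzero \<open>B\<close> with
  \<open>B ** A n = 0\<close> yields a polynomial \<open>const_mat B ** P n\<close> of degree
  \<open>n\<close> that \<open>E\<close> annihilates.\<close>

lemma invertible_of_degree_preserving:
  fixes P Q :: "nat \<Rightarrow> 'n::finite matpoly"
  assumes "degree_basis P" "degree_basis Q" "\<And>n. diffop_act (P n) E = const_mat (A n) ** Q n"
    "degree_preserving E"
  obtains n where "invertible (A n)"
proof -
  \<comment> \<open>Index 0 is avoided because annihilation contradicts degree \<open>n\<close> only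
    for positive \<open>n\<close>.\<close>
  let ?X = "insert 0 {n. \<not> (\<forall>f. mat_degree f = n \<longrightarrow> mat_degree (diffop_act f E) = n)}"
  have "finite ?X"
    using assms(4) by (simp add: degree_preserving_def)
  then obtain n where "n \<notin> ?X"
    using ex_new_if_finite[OF infinite_UNIV_nat] by blast
  then have n: "n > 0" "\<And>f. mat_degree f = n \<Longrightarrow> mat_degree (diffop_act f E) = n"
    by auto
  have "invertible (A n)"
  proof (rule ccontr)
    assume "\<not> invertible (A n)"
    then obtain B :: "complex ^ 'n ^ 'n" where B: "B \<noteq> 0" "B ** A n = 0"
      using not_invertible_left_kernel[of "A n"] by blast
    have "mat_degree (const_mat B ** P n) = n"
    proof (rule mat_degree_eqI)
      show "mat_degree (const_mat B ** P n) \<le> n"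
        using degree_basisD[OF assms(1)]
        by (simp add: mat_degree_le_iff mat_coeff_const_mult mat_coeff_eq_0)
      show "mat_coeff (const_mat B ** P n) n \<noteq> 0"
        using degree_basisD[OF assms(1)] B(1) by (simp add: mat_coeff_const_mult mult_invertible_eq_0_iff)
    qed
    from n(2)[OF this] have "mat_coeff (diffop_act (const_mat B ** P n) E) n \<noteq> 0"
      using n(1) mat_coeff_degree_neq_0 by blast
    moreover have "diffop_act (const_mat B ** P n) E = 0"
      using B(2) by (simp add: left_linearD[OF left_linear_diffop_act] assms(3) matrix_mul_assoc const_mat_mult)
    ultimately show False by simp
  qed
  then show thesis using that by blast
qed

section \<open>Matrix-valued inner products\<close>

lemma mat_eval_eq_sum:
  assumes "mat_degree P \<le> m"
  shows "mat_eval P x = (\<Sum>a\<le>m. x ^ a *\<^sub>R mat_coeff P a)"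
proof -
  have "poly (P $ i $ j) (of_real x) = (\<Sum>a\<le>m. x ^ a *\<^sub>R coeff (P $ i $ j) a)" for i j
  proof -
    have "coeff (P $ i $ j) a = 0" if "a > m" for a
      using mat_coeff_eq_0[of P a] assms that by (simp add: vec_eq_iff mat_coeff_nth)
    then have "degree (P $ i $ j) \<le> m"
      by (simp add: degree_le)
    then have "poly (P $ i $ j) (of_real x) = (\<Sum>a\<le>m. coeff (P $ i $ j) a * of_real x ^ a)"
      unfolding poly_altdef by (intro sum.mono_neutral_left) (auto simp: coeff_eq_0)
    then show ?thesis by (simp add: scaleR_conv_of_real mult.commute)
  qed
  then show ?thesis
    by (simp add: vec_eq_iff mat_eval_def mat_coeff_nth)
qed

lemma mat_eval_add: "mat_eval (P + Q) x = mat_eval P x + mat_eval Q x"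
  by (simp add: vec_eq_iff mat_eval_def)

lemma mat_eval_const_mult: "mat_eval (const_mat A ** P) x = A ** mat_eval P x"
  by (simp add: vec_eq_iff mat_eval_def const_mat_def matrix_matrix_mult_def poly_sum)

lemma mat_eval_shift: "mat_eval (mat_shift P) x = x *\<^sub>R mat_eval P x"
  by (simp add: vec_eq_iff mat_eval_def nth_mat_shift) (simp add: scaleR_conv_of_real)

lemma hermitian_conj_nth: "hermitian_conj A $ i $ j = cnj (A $ j $ i)"
  by (simp add: hermitian_conj_def transpose_def)

lemma hermitian_conj_add: "hermitian_conj (A + B) = hermitian_conj A + hermitian_conj B"
  by (simp add: vec_eq_iff hermitian_conj_nth)

lemma hermitian_conj_scaleR: "hermitian_conj (c *\<^sub>R A) = c *\<^sub>R hermitian_conj A"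
  by (simp add: vec_eq_iff hermitian_conj_nth)

lemma hermitian_conj_sum: "hermitian_conj (\<Sum>i\<in>I. f i) = (\<Sum>i\<in>I. hermitian_conj (f i))"
  by (simp add: vec_eq_iff hermitian_conj_nth)

lemma hermitian_conj_mult: "hermitian_conj (A ** B) = hermitian_conj B ** hermitian_conj A"
  by (simp add: vec_eq_iff hermitian_conj_nth matrix_matrix_mult_def mult.commute)

lemma invertible_hermitian_conj: "invertible A \<Longrightarrow> invertible (hermitian_conj A)"
proof -
  have "hermitian_conj (mat 1) = (mat 1 :: complex ^ 'a ^ 'a)"
    by (simp add: vec_eq_iff hermitian_conj_nth mat_def)
  then show "invertible A \<Longrightarrow> invertible (hermitian_conj A)"
    unfolding invertible_def by (metis hermitian_conj_mult)
qed

lemma mat_mult_scaleR: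
  fixes A :: "'a::real_algebra_1 ^ 'n ^ 'n::finite"
  shows "(c *\<^sub>R A) ** B = c *\<^sub>R (A ** B)" "A ** (c *\<^sub>R B) = c *\<^sub>R (A ** B)"
  by (simp_all add: vec_eq_iff matrix_matrix_mult_def scaleR_sum_right)

lemma bounded_linear_mat_mult:
  fixes A B :: "complex ^ 'n ^ 'n::finite"
  shows "bounded_linear (\<lambda>X. A ** X ** B)"
  unfolding linear_conv_bounded_linear[symmetric]
  by (rule linearI) (simp_all add: matrix_add_ldistrib mat_mult_add_rdistrib mat_mult_scaleR)

lemma set_integrable_bounded_linear:
  assumes "bounded_linear T" "set_integrable M A f"
  shows "set_integrable M A (\<lambda>x. T (f x))"
  using integrable_bounded_linear[OF assms(1), of M "\<lambda>x. indicator A x *\<^sub>R f x"] assms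
  by (simp add: set_integrable_def linear_scale[OF bounded_linear.linear])

lemma set_integral_bounded_linear:
  assumes "bounded_linear T" "set_integrable M A f"
  shows "(LINT x:A|M. T (f x)) = T (LINT x:A|M. f x)"
  using integral_bounded_linear[OF assms(1), of M "\<lambda>x. indicator A x *\<^sub>R f x"] assms
  by (simp add: set_integrable_def set_lebesgue_integral_def linear_scale[OF bounded_linear.linear])

context
  fixes x0 x1 :: ereal and W :: "real \<Rightarrow> complex ^ 'n ^ 'n::finite"
  assumes weight: "weight_matrix x0 x1 W"
begin

text \<open>Expanding both polynomials turns the integrand into a finite sum of moment integrands
  between constant matrices.\<close>

lemma set_integrable_weight_inner:
  "set_integrable lborel (einterval x0 x1)
    (\<lambda>x. mat_eval P x ** W x ** hermitian_conj (mat_eval Q x))"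
proof -
  have eq: "mat_eval P x ** W x ** hermitian_conj (mat_eval Q x) =
      (\<Sum>a\<le>mat_degree P. \<Sum>b\<le>mat_degree Q.
        mat_coeff P a ** (x ^ (a + b) *\<^sub>R W x) ** hermitian_conj (mat_coeff Q b))" for x
  proof -
    have sum_left: "(\<Sum>i\<in>I. f i) ** B = (\<Sum>i\<in>I. f i ** B)"
      for f :: "nat \<Rightarrow> complex ^ 'n ^ 'n" and I B
      by (induction I rule: infinite_finite_induct) (simp_all add: mat_mult_add_rdistrib)
    show ?thesis
      by (simp add: mat_eval_eq_sum[OF order_refl] hermitian_conj_sum hermitian_conj_scaleR sum_left
          mat_mult_sum_right mat_mult_scaleR power_add scaleR_sum_right mult.commute)
         (subst sum.swap, simp add: mult.commute)
  qed
  have "set_integrable lborel (einterval x0 x1) (\<lambda>x. A ** (x ^ k *\<^sub>R W x) ** B)"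
    for A B :: "complex ^ 'n ^ 'n" and k
    by (rule set_integrable_bounded_linear[OF bounded_linear_mat_mult, where f = "\<lambda>x. x ^ k *\<^sub>R W x"])
       (use weight in \<open>simp add: weight_matrix_def\<close>)
  then show ?thesis
    unfolding set_integrable_def scaleR_sum_right eq by (intro Bochner_Integration.integrable_sum)
qed

lemma weight_inner_add_left:
  "weight_inner x0 x1 W (P + Q) R = weight_inner x0 x1 W P R + weight_inner x0 x1 W Q R"
  unfolding weight_inner_def mat_eval_add mat_mult_add_rdistrib
  by (intro set_integral_add set_integrable_weight_inner)

lemma weight_inner_add_right:
  "weight_inner x0 x1 W R (P + Q) = weight_inner x0 x1 W R P + weight_inner x0 x1 W R Q"
  unfolding weight_inner_def mat_eval_add hermitian_conj_add matrix_add_ldistrib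
  by (intro set_integral_add set_integrable_weight_inner)

lemma weight_inner_const_left:
  "weight_inner x0 x1 W (const_mat A ** P) Q = A ** weight_inner x0 x1 W P Q"
  using set_integral_bounded_linear[OF bounded_linear_mat_mult[of A "mat 1"] set_integrable_weight_inner]
  by (simp add: weight_inner_def mat_eval_const_mult matrix_mul_assoc)

lemma weight_inner_const_right:
  "weight_inner x0 x1 W P (const_mat A ** Q) = weight_inner x0 x1 W P Q ** hermitian_conj A"
  using set_integral_bounded_linear[OF bounded_linear_mat_mult[of "mat 1" "hermitian_conj A"]
      set_integrable_weight_inner]
  by (simp add: weight_inner_def mat_eval_const_mult matrix_mul_assoc hermitian_conj_mult)

lemma weight_inner_zero_left [simp]: "weight_inner x0 x1 W 0 Q = 0"
  using weight_inner_add_left[of 0 0 Q] by simp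

lemma weight_inner_zero_right [simp]: "weight_inner x0 x1 W Q 0 = 0"
  using weight_inner_add_right[of Q 0 0] by simp

lemma weight_inner_diff_left:
  "weight_inner x0 x1 W (P - Q) R = weight_inner x0 x1 W P R - weight_inner x0 x1 W Q R"
  using weight_inner_add_left[of "P - Q" Q R] by simp

lemma weight_inner_diff_right:
  "weight_inner x0 x1 W R (P - Q) = weight_inner x0 x1 W R P - weight_inner x0 x1 W R Q"
  using weight_inner_add_right[of R "P - Q" Q] by simp

lemma weight_inner_sum_left:
  "weight_inner x0 x1 W (\<Sum>i\<in>I. f i) Q = (\<Sum>i\<in>I. weight_inner x0 x1 W (f i) Q)"
  by (induction I rule: infinite_finite_induct) (simp_all add: weight_inner_add_left)

lemma weight_inner_sum_right:
  "weight_inner x0 x1 W Q (\<Sum>i\<in>I. f i) = (\<Sum>i\<in>I. weight_inner x0 x1 W Q (f i))"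
  by (induction I rule: infinite_finite_induct) (simp_all add: weight_inner_add_right)

end

text \<open>The variable is real, so it passes through the Hermitian conjugate unchanged.\<close>

lemma weight_inner_shift:
  "weight_inner x0 x1 W (mat_shift P) Q = weight_inner x0 x1 W P (mat_shift Q)"
  by (simp add: weight_inner_def mat_eval_shift hermitian_conj_scaleR mat_mult_scaleR)

section \<open>Positivity and invertibility of squared norms\<close>

definition quadratic_form :: "complex ^ 'n ^ 'n::finite \<Rightarrow> complex ^ 'n \<Rightarrow> real" where
  "quadratic_form A v = Re (\<Sum>i\<in>UNIV. \<Sum>j\<in>UNIV. cnj (v $ i) * A $ i $ j * v $ j)"

lemma quadratic_form_eq: "quadratic_form A v = Re (\<Sum>i\<in>UNIV. cnj (v $ i) * (A *v v) $ i)"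
  by (simp add: quadratic_form_def matrix_vector_mult_def sum_distrib_left mult.assoc)

lemma quadratic_form_congruence:
  "quadratic_form (A ** B ** hermitian_conj A) v = quadratic_form B (hermitian_conj A *v v)"
proof -
  have "(\<Sum>i\<in>UNIV. cnj (v $ i) * (A *v u) $ i) = (\<Sum>k\<in>UNIV. cnj ((hermitian_conj A *v v) $ k) * u $ k)" for u
    by (simp add: matrix_vector_mult_def hermitian_conj_nth sum_distrib_left sum_distrib_right mult_ac)
       (rule sum.swap)
  then show ?thesis
    by (simp add: quadratic_form_eq flip: matrix_vector_mul_assoc)
qed

lemma bounded_linear_quadratic_form: "bounded_linear (\<lambda>A. quadratic_form A v)"
  unfolding linear_conv_bounded_linear[symmetric] quadratic_form_def
  by (rule linearI) (simp_all add: algebra_simps sum.distrib sum_distrib_left)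

text \<open>The entries of the vector are, up to conjugation, polynomials in x. They cannot all be
  zero, since their coefficients at \<open>n\<close> come from an invertible matrix applied to
  \<open>y\<close>; a nonzero one has a finite, hence null, zero set.\<close>

lemma AE_hermitian_conj_mult_neq_0:
  fixes P :: "'n::finite matpoly"
  assumes "invertible (mat_coeff P n)" "y \<noteq> 0"
  shows "AE x in lborel. hermitian_conj (mat_eval P x) *v y \<noteq> 0"
proof -
  \<comment> \<open>The entries are conjugated so that the coefficients of \<open>P\<close> appear
    unconjugated.\<close>
  define p where "p k = (\<Sum>i\<in>UNIV. smult (cnj (y $ i)) (P $ i $ k))" for k
  have eval: "cnj ((hermitian_conj (mat_eval P x) *v y) $ k) = poly (p k) (of_real x)" for x k
    by (simp add: p_def matrix_vector_mult_def hermitian_conj_nth poly_sum mat_eval_def mult.commute)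
  have "\<exists>k. p k \<noteq> 0"
  proof (rule ccontr)
    assume "\<not> ?thesis"
    then have "coeff (p k) n = 0" for k by simp
    then have "cnj ((hermitian_conj (mat_coeff P n) *v y) $ k) = 0" for k
      by (simp add: p_def matrix_vector_mult_def hermitian_conj_nth coeff_sum mat_coeff_nth mult.commute)
    then have "hermitian_conj (mat_coeff P n) *v y = 0"
      by (simp add: vec_eq_iff)
    with invertible_hermitian_conj[OF assms(1)] assms(2) show False
      by (simp add: invertible_left_inverse matrix_left_invertible_ker)
  qed
  then obtain k where "p k \<noteq> 0" by blast
  then have "finite (complex_of_real -` {z. poly (p k) z = 0})"
    by (intro finite_vimageI poly_roots_finite) (auto simp: inj_def)
  then have "complex_of_real -` {z. poly (p k) z = 0} \<in> null_sets lborel"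
    by (rule finite_imp_null_set_lborel)
  then show ?thesis
    by (rule AE_I') (auto simp flip: eval)
qed

text \<open>Density of the reals gives a bounded open subinterval of positive length, also when an
  endpoint is infinite.\<close>

lemma einterval_not_null:
  assumes "x0 < x1"
  shows "\<not> (AE x in lborel. x \<notin> einterval x0 x1)"
proof
  assume null: "AE x in lborel. x \<notin> einterval x0 x1"
  obtain a where a: "x0 < ereal a" "ereal a < x1"
    using ereal_dense2[OF assms] by blast
  obtain b where b: "ereal a < ereal b" "ereal b < x1"
    using ereal_dense2[OF a(2)] by blast
  have "AE x in lborel. x \<notin> {a<..<b}"
    using null
  proof (eventually_elim)
    case (elim x)
    have "x \<in> einterval x0 x1" if "x \<in> {a<..<b}"
      using that less_trans[OF a(1), of "ereal x"] less_trans[OF _ b(2), of "ereal x"]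
      by (simp add: einterval_def)
    with elim show ?case by blast
  qed
  then have "emeasure lborel {a<..<b} = 0"
    by (subst (asm) AE_iff_null_sets[symmetric]) (auto simp: null_sets_def)
  with b(1) show False by simp
qed

text \<open>A kernel vector \<open>y\<close> would make the integral of the quadratic form at
  \<open>y\<close> zero, although the integrand is positive almost everywhere on an interval that is
  not null.\<close>

lemma invertible_weight_inner:
  fixes W :: "real \<Rightarrow> complex ^ 'n ^ 'n::finite"
  assumes "x0 < x1" "weight_matrix x0 x1 W" "invertible (mat_coeff P n)"
  shows "invertible (weight_inner x0 x1 W P P)"
proof (rule ccontr)
  assume "\<not> ?thesis"
  then obtain y where y: "y \<noteq> 0" "weight_inner x0 x1 W P P *v y = 0"
    by (auto simp: invertible_left_inverse matrix_left_invertible_ker)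
  let ?I = "einterval x0 x1"
  define g where "g x = quadratic_form (mat_eval P x ** W x ** hermitian_conj (mat_eval P x)) y" for x
  note int = set_integrable_weight_inner[OF assms(2), of P P]
  have "set_integrable lborel ?I g"
    unfolding g_def by (rule set_integrable_bounded_linear[OF bounded_linear_quadratic_form int])
  then have integrable: "integrable lborel (\<lambda>x. indicator ?I x *\<^sub>R g x)"
    by (simp add: set_integrable_def)
  have "(LBINT x:?I. g x) = quadratic_form (weight_inner x0 x1 W P P) y"
    unfolding g_def weight_inner_def
    by (rule set_integral_bounded_linear[OF bounded_linear_quadratic_form int])
  also have "\<dots> = 0"
    by (simp add: quadratic_form_eq y(2))
  finally have zero: "(LBINT x. indicator ?I x *\<^sub>R g x) = 0"
    by (simp add: set_lebesgue_integral_def)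
  have "AE x in lborel. x \<in> ?I \<longrightarrow> positive_definite (W x)"
    using assms(2) by (simp add: weight_matrix_def)
  then have pos: "AE x in lborel. x \<in> ?I \<longrightarrow> g x > 0"
    using AE_hermitian_conj_mult_neq_0[OF assms(3) y(1)]
    by eventually_elim
       (simp add: g_def quadratic_form_congruence, simp add: positive_definite_def quadratic_form_def)
  then have "AE x in lborel. 0 \<le> indicator ?I x *\<^sub>R g x"
    by eventually_elim (auto simp: indicator_def)
  then have "AE x in lborel. indicator ?I x *\<^sub>R g x = 0"
    using integral_nonneg_eq_0_iff_AE[OF integrable] zero by simp
  with pos have "AE x in lborel. x \<notin> ?I"
    by eventually_elim (auto simp: indicator_def)
  with einterval_not_null[OF assms(1)] show False ..
qed

section \<open>Adjoint operators\<close>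

lemma orthogonal_polysD:
  assumes "orthogonal_polys x0 x1 W P"
  shows "degree_basis P" "n \<noteq> m \<Longrightarrow> weight_inner x0 x1 W (P n) (P m) = 0"
  using assms by (auto simp: orthogonal_polys_def degree_basis_def)

lemma weight_inner_expansion:
  assumes "weight_matrix x0 x1 W" "orthogonal_polys x0 x1 W P" "finite K"
  shows "weight_inner x0 x1 W (\<Sum>k\<in>K. const_mat (C k) ** P k) (P j) =
    (if j \<in> K then C j ** weight_inner x0 x1 W (P j) (P j) else 0)"
proof -
  have "weight_inner x0 x1 W (\<Sum>k\<in>K. const_mat (C k) ** P k) (P j) =
      (\<Sum>k\<in>K. if k = j then C j ** weight_inner x0 x1 W (P j) (P j) else 0)"
    using orthogonal_polysD(2)[OF assms(2)]
    by (auto simp: weight_inner_sum_left[OF assms(1)] weight_inner_const_left[OF assms(1)]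
        intro!: sum.cong)
  then show ?thesis using assms(3) by simp
qed

context
  fixes x0 x1 :: ereal and W :: "real \<Rightarrow> complex ^ 'n ^ 'n::finite" and P :: "nat \<Rightarrow> 'n matpoly"
  assumes interval: "x0 < x1" and weight: "weight_matrix x0 x1 W"
    and orth: "orthogonal_polys x0 x1 W P"
begin

lemma invertible_squared_norm: "invertible (weight_inner x0 x1 W (P k) (P k))"
  using degree_basisD(2)[OF orthogonal_polysD(1)[OF orth]]
  by (rule invertible_weight_inner[OF interval weight])

text \<open>Pairing \<open>Q - R\<close> with \<open>P j\<close> isolates one expansion coefficient,
  multiplied by an invertible squared norm.\<close>

lemma weight_inner_eqI:
  assumes "\<And>k. weight_inner x0 x1 W Q (P k) = weight_inner x0 x1 W R (P k)"
  shows "Q = R"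
proof -
  obtain C where C: "Q - R = (\<Sum>k\<le>mat_degree (Q - R). const_mat (C k) ** P k)"
    using degree_basis_expansion[OF orthogonal_polysD(1)[OF orth] order_refl] by blast
  have "C j = 0" if "j \<le> mat_degree (Q - R)" for j
  proof -
    have "weight_inner x0 x1 W (Q - R) (P j) = 0"
      using assms by (simp add: weight_inner_diff_left[OF weight])
    then show ?thesis
      using that by (subst (asm) C) (simp add: weight_inner_expansion[OF weight orth]
          mult_invertible_eq_0_iff[OF invertible_squared_norm])
  qed
  then have "Q - R = 0"
    by (subst C) simp
  then show ?thesis by simp
qed

lemma weight_inner_degree_less:
  assumes "mat_degree Q < k"
  shows "weight_inner x0 x1 W Q (P k) = 0"
proof -
  obtain C where "Q = (\<Sum>k\<le>mat_degree Q. const_mat (C k) ** P k)"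
    using degree_basis_expansion[OF orthogonal_polysD(1)[OF orth] order_refl] by blast
  then show ?thesis
    using weight_inner_expansion[OF weight orth, of "{..mat_degree Q}" C k] assms by simp
qed

text \<open>Multiplication by x is symmetric, so taking commutators of \<open>S\<close> and
  \<open>T\<close> with x preserves adjointness up to sign; the scalar \<open>c\<close> absorbs the
  signs. At the end \<open>S\<close> is zero, and \<open>weight_inner_eqI\<close> gives the same for
  \<open>T\<close>.\<close>

lemma shift_ad_pow_adjoint:
  assumes "weight_matrix x0 x1 Wt"
    and "\<And>Q F. weight_inner x0 x1 W (T Q) F = c *\<^sub>R weight_inner x0 x1 Wt Q (S F)"
    and "(shift_ad ^^ m) S = (\<lambda>_. 0)"
  shows "(shift_ad ^^ m) T = (\<lambda>_. 0)"
  using assms(2,3)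
proof (induction m arbitrary: S T c)
  case 0
  then have "weight_inner x0 x1 W (T Q) F = 0" for Q F
    by (simp add: weight_inner_zero_right[OF assms(1)])
  then show ?case
    using weight_inner_eqI[of "T _" 0] by (simp add: fun_eq_iff weight_inner_zero_left[OF weight])
next
  case (Suc m)
  have "weight_inner x0 x1 W (shift_ad T Q) F = (- c) *\<^sub>R weight_inner x0 x1 Wt Q (shift_ad S F)" for Q F
    by (simp add: shift_ad_def weight_inner_diff_left[OF weight] weight_inner_diff_right[OF assms(1)]
        weight_inner_shift Suc.prems(1) scaleR_diff_right)
  moreover have "(shift_ad ^^ m) (shift_ad S) = (\<lambda>_. 0)"
    using Suc.prems(2) by (simp add: funpow_swap1)
  ultimately have "(shift_ad ^^ m) (shift_ad T) = (\<lambda>_. 0)"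
    by (rule Suc.IH)
  then show ?case by (simp add: funpow_swap1)
qed

end

text \<open>The adjoint is first built as a plain map. Uniqueness makes it left linear, and its
  commutators with x vanish along with those of \<open>V\<close>, so it is a differential
  operator.\<close>

lemma adjoint_diffop_exists:
  fixes W Wt :: "real \<Rightarrow> complex ^ 'n ^ 'n::finite"
  assumes interval: "x0 < x1"
    and weight: "weight_matrix x0 x1 W" and orth: "orthogonal_polys x0 x1 W P"
    and weight': "weight_matrix x0 x1 Wt" and orth': "orthogonal_polys x0 x1 Wt Pt"
    and V: "\<And>n. diffop_act (P n) V = const_mat (A n) ** Pt n"
  obtains N where "\<And>Q F. weight_inner x0 x1 W (diffop_act Q N) F =
    weight_inner x0 x1 Wt Q (diffop_act F V)"
proof -
  have "\<exists>R. \<forall>k. weight_inner x0 x1 W R (P k) = weight_inner x0 x1 Wt Q (diffop_act (P k) V)" for Q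
  proof -
    \<comment> \<open>The Fourier expansion of the desired image. It stops at the degree of
      \<open>Q\<close> because \<open>diffop_act (P k) V\<close> is a multiple of
      \<open>Pt k\<close>, which is orthogonal to everything of lower degree.\<close>
    define R where "R = (\<Sum>k\<le>mat_degree Q. const_mat (weight_inner x0 x1 Wt Q (diffop_act (P k) V) **
      matrix_inv (weight_inner x0 x1 W (P k) (P k))) ** P k)"
    have "weight_inner x0 x1 W R (P k) = weight_inner x0 x1 Wt Q (diffop_act (P k) V)" for k
      unfolding R_def
      by (simp add: weight_inner_expansion[OF weight orth] V mat_mult_inverse_cancel
          invertible_squared_norm[OF interval weight orth] weight_inner_const_right[OF weight']
          weight_inner_degree_less[OF interval weight' orth'])
    then show ?thesis by blast
  qed
  then obtain T where T: "\<And>Q k. weight_inner x0 x1 W (T Q) (P k) =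
      weight_inner x0 x1 Wt Q (diffop_act (P k) V)"
    by metis
  have adj: "weight_inner x0 x1 W (T Q) F = weight_inner x0 x1 Wt Q (diffop_act F V)" for Q F
  proof -
    obtain C where C: "F = (\<Sum>k\<le>mat_degree F. const_mat (C k) ** P k)"
      using degree_basis_expansion[OF orthogonal_polysD(1)[OF orth] order_refl] by blast
    show ?thesis
      by (subst (1 2) C) (simp add: left_linear_sum[OF left_linear_diffop_act]
          left_linearD[OF left_linear_diffop_act] weight_inner_sum_right[OF weight]
          weight_inner_sum_right[OF weight'] weight_inner_const_right[OF weight]
          weight_inner_const_right[OF weight'] T)
  qed
  have "left_linear T"
    unfolding left_linear_def
    by (intro conjI allI weight_inner_eqI[OF interval weight orth])
       (simp_all add: adj weight_inner_add_left[OF weight] weight_inner_add_left[OF weight']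
         weight_inner_const_left[OF weight] weight_inner_const_left[OF weight'])
  moreover have "(shift_ad ^^ Suc (degree V)) T = (\<lambda>_. 0)"
    by (rule shift_ad_pow_adjoint[OF interval weight orth weight', of T 1 "\<lambda>F. diffop_act F V"])
       (simp_all add: adj shift_ad_pow_diffop_act del: funpow.simps)
  ultimately obtain N where "\<And>Q. diffop_act Q N = T Q"
    using diffop_of_shift_ad by blast
  then show thesis
    by (intro that[of N]) (simp add: adj)
qed

theorem theorem3p4:
  fixes x0 x1 :: ereal
    and W Wt :: "real \<Rightarrow> complex ^ 'n ^ 'n::finite"
    and P Pt :: "nat \<Rightarrow> 'n matpoly"
  assumes "x0 < x1"
    and "weight_matrix x0 x1 W"
    and "weight_matrix x0 x1 Wt"
    and "good_weight x0 x1 W"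
    and "good_weight x0 x1 Wt"
    and "good_weight x0 x1 (direct_sum W Wt)"
    and "orthogonal_polys x0 x1 W P"
    and "orthogonal_polys x0 x1 Wt Pt"
  shows "(\<exists>V A. (\<forall>n. diffop_act (P n) V = const_mat (A n) ** Pt n) \<and> (\<exists>n. invertible (A n)))
    \<longleftrightarrow> darboux_transformation x0 x1 W P Pt"
proof
  note basis = orthogonal_polysD(1)[OF assms(7)] orthogonal_polysD(1)[OF assms(8)]
  let ?in = "weight_inner x0 x1 W" and ?int = "weight_inner x0 x1 Wt"
  assume "\<exists>V A. (\<forall>n. diffop_act (P n) V = const_mat (A n) ** Pt n) \<and> (\<exists>n. invertible (A n))"
  then obtain V A m where V: "\<And>n. diffop_act (P n) V = const_mat (A n) ** Pt n"
    and m: "invertible (A m)" by blast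
  obtain N where adj: "\<And>Q F. ?in (diffop_act Q N) F = ?int Q (diffop_act F V)"
    using adjoint_diffop_exists[OF assms(1,2,7,3,8) V]
    by blast
  \<comment> \<open>Forced by pairing \<open>diffop_act (Pt n) N\<close> with \<open>P n\<close> and
    moving \<open>N\<close> across as \<open>V\<close>.\<close>
  define B where "B n = ?int (Pt n) (Pt n) ** hermitian_conj (A n) ** matrix_inv (?in (P n) (P n))" for n
  have N: "diffop_act (Pt n) N = const_mat (B n) ** P n" for n
  proof (rule weight_inner_eqI[OF assms(1,2,7)])
    show "?in (diffop_act (Pt n) N) (P k) = ?in (const_mat (B n) ** P n) (P k)" for k
    proof (cases "k = n")
      case True
      then show ?thesis
        by (simp add: adj V B_def weight_inner_const_left[OF assms(2)] weight_inner_const_right[OF assms(3)]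
            mat_mult_inverse_cancel invertible_squared_norm[OF assms(1,2,7)])
    next
      case False
      then show ?thesis
        using orthogonal_polysD(2)[OF assms(7)] orthogonal_polysD(2)[OF assms(8)]
        by (simp add: adj V weight_inner_const_left[OF assms(2)] weight_inner_const_right[OF assms(3)])
    qed
  qed
  have "invertible (B m)"
    unfolding B_def
    by (intro invertible_mult invertible_matrix_inv invertible_hermitian_conj m
        invertible_squared_norm[OF assms(1,2,7)] invertible_squared_norm[OF assms(1,3,8)])
  \<comment> \<open>\<open>N\<close> leads from \<open>Pt\<close> back to \<open>P\<close>, so the
    two bases swap roles.\<close>
  then have "degree_preserving N"
    using degree_preserving_of_invertible[OF basis(2,1) N] by blast
  moreover have "degree_preserving V"
    by (rule degree_preserving_of_invertible[OF basis V m])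
  moreover have "diffop_act (P n) (diffop_mult V N) = const_mat (A n ** B n) ** P n" for n
    by (simp add: diffop_act_mult V N left_linearD[OF left_linear_diffop_act] matrix_mul_assoc
        flip: const_mat_mult)
  \<comment> \<open>\<open>P\<close> itself witnesses the existential in
    \<open>weight_algebra\<close>, with eigenvalues \<open>A n ** B n\<close>.\<close>
  then have "diffop_mult V N \<in> weight_algebra x0 x1 W"
    unfolding weight_algebra_def using assms(7) by blast
  ultimately show "darboux_transformation x0 x1 W P Pt"
    unfolding darboux_transformation_def using V by blast
next
  assume "darboux_transformation x0 x1 W P Pt"
  then obtain V A where V: "degree_preserving V" "\<And>n. diffop_act (P n) V = const_mat (A n) ** Pt n"
    unfolding darboux_transformation_def by blast
  \<comment> \<open>The factor \<open>V\<close> is already the intertwiner; its degree preservation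
    forces some \<open>A n\<close> to be invertible.\<close>
  then obtain n where "invertible (A n)"
    using invertible_of_degree_preserving orthogonal_polysD(1) assms(7,8) by metis
  with V(2) show "\<exists>V A. (\<forall>n. diffop_act (P n) V = const_mat (A n) ** Pt n) \<and> (\<exists>n. invertible (A n))"
    by blast
qed

end
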